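(* Let $b^{\ast}>0$, let $I\subset[0,b^{\ast}]$ be an interval with interior $I^{\circ}$, and let $f:I\to\mathbb{R}$ be a twice differentiable mapping on $I^{\circ}$ such that $f''\in L[a,b]$, where $a,b\in I$ with $a<b$. If $|f''|^{q}$ is $(\alpha,m)$-convex on $[a,b]$ for $(\alpha,m)\in[0,1]^2$, $q>1$, $\frac1p+\frac1q=1$, then the following inequality holds: $$\left|\frac{f(a)+f(mb)}{2}-\frac{1}{mb-a}\int_{a}^{mb}f(x)\,dx\right|\le\frac{(mb-a)^2}{2}\left(|f''(a)|^{q}\beta(\alpha+1,q+1)+m|f''(b)|^{q}\left(\frac{1}{q+1}-\beta(\alpha+1,q+1)\right)\right)^{\frac1q}.$$
   Context: $\beta(x,y)=\int_0^1 t^{x-1}(1-t)^{y-1}\,dt$, $x,y>0$, is the Beta function, and $L[a,b]$ denotes the space of integrable functions on $[a,b]$. For $(\alpha,m)\in[0,1]^2$, a function $g:[0,b]\to\mathbb{R}$ is said to be $(\alpha,m)$-convex if $g(tx+m(1-t)y)\le t^{\alpha}g(x)+m(1-t^{\alpha})g(y)$ for every $x,y\in[0,b]$ and $t\in[0,1]$; "$(\alpha,m)$-convex on $[a,b]$" refers to the same inequality with $x,y\in[a,b]$ and $t\in[0,1]$. The exponent $p$ does not appear in the conclusion. *)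

theory Defs
  imports "HOL-Analysis.Analysis"
begin

text \<open>The power \<open>t\<^sup>\<alpha>\<close> for \<open>t \<ge> 0\<close>, \<open>\<alpha> \<ge> 0\<close>, with the convention \<open>0\<^sup>0 = 1\<close>;
  the library's \<open>powr\<close> instead has \<open>0 powr 0 = 0\<close>. Under this convention (0,0)-convexity
  is monotonicity on \<open>[0,b]\<close>, as it should be.\<close>

definition rpow :: "real \<Rightarrow> real \<Rightarrow> real" where
  "rpow t \<alpha> = (if \<alpha> = 0 then 1 else t powr \<alpha>)"

text \<open>The point \<open>t * x + m * (1 - t) * y\<close> need not belong to \<open>S\<close>: only \<open>x\<close> and \<open>y\<close> are
  restricted to it.\<close>

definition alpha_m_convex_on :: "real \<Rightarrow> real \<Rightarrow> real set \<Rightarrow> (real \<Rightarrow> real) \<Rightarrow> bool" where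
  "alpha_m_convex_on \<alpha> m S g \<longleftrightarrow>
     (\<forall>x\<in>S. \<forall>y\<in>S. \<forall>t\<in>{0..1}.
        g (t * x + m * (1 - t) * y) \<le> rpow t \<alpha> * g x + m * (1 - rpow t \<alpha>) * g y)"

text \<open>The library defines \<open>Beta\<close> through \<open>Gamma\<close>; for positive real arguments it is Euler's integral.\<close>

lemma Beta_eq_integral:
  fixes x y :: real
  assumes "x > 0" "y > 0"
  shows "Beta x y = integral {0..1} (\<lambda>t. t powr (x - 1) * (1 - t) powr (y - 1))"
  using has_integral_Beta_real[OF assms] by (simp add: integral_unique)

end

theory Submission
  imports Defs
begin

text \<open>
  Write \<open>c = m * b\<close>. Integrating \<open>t * (1 - t) * f'' (t * a + (1 - t) * c)\<close> twice by parts over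
  \<open>[0,1]\<close> turns the error of the trapezoidal rule on the segment between \<open>a\<close> and \<open>c\<close> into
  \<open>(c - a)\<^sup>2 / 2\<close> times this integral (\<open>trapezoid_error_has_integral\<close>); the order of \<open>a\<close> and \<open>c\<close>
  is immaterial. By \<open>t \<le> 1\<close> and convexity, the \<open>q\<close>-th power of the absolute value of the
  integrand is at most
  \<open>(1 - t) powr q * (t\<^sup>\<alpha> * \<bar>f'' a\<bar> powr q + m * (1 - t\<^sup>\<alpha>) * \<bar>f'' b\<bar> powr q)\<close>,
  whose integral is the combination of Beta values in the bracket (\<open>rpow_has_integral_Beta\<close>).
  Since \<open>[0,1]\<close> has length 1, the power mean inequality (\<open>abs_integral_le_root_integral\<close>)
  finishes the proof.

  The integrals over \<open>[0,1]\<close> are gauge integrals: when \<open>c < a\<close> the segment leaves \<open>[a,b]\<close>, and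
  there the integrability of \<open>f''\<close> comes from the fundamental theorem of calculus, which for gauge
  integrals makes every derivative integrable. The convexity inequality needs only \<open>a\<close> and \<open>b\<close> in
  \<open>[a,b]\<close>, so it still bounds \<open>f''\<close> on this segment.
\<close>

text \<open>
  This is Jensen's inequality for the \<open>q\<close>-th power on a set of length 1. Instead of integrating
  \<open>\<bar>\<phi>\<bar> powr q\<close>, whose integrability would need an argument, the proof integrates the majorant \<open>\<psi>\<close>:
  for \<open>M\<close> above the claimed bound, Young's inequality estimates \<open>\<bar>\<phi>\<bar> * M powr (q - 1)\<close> by a convex
  combination of \<open>\<bar>\<phi>\<bar> powr q \<le> \<psi>\<close> and \<open>M powr q\<close>, and the integral of that combination is at most
  \<open>M powr q\<close>. Taking \<open>M\<close> strictly above the bound keeps it positive, also for \<open>j = 0\<close>.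
\<close>

lemma abs_integral_le_root_integral:
  fixes \<phi> \<psi> :: "real \<Rightarrow> real"
  assumes q: "q > 1"
    and \<phi>: "(\<phi> has_integral i) {0..1}" and \<psi>: "(\<psi> has_integral j) {0..1}"
    and le: "\<And>t. t \<in> {0..1} \<Longrightarrow> \<bar>\<phi> t\<bar> powr q \<le> \<psi> t"
  shows "\<bar>i\<bar> \<le> j powr (1 / q)"
proof (rule dense_ge)
  fix M assume M: "j powr (1 / q) < M"
  have j: "j \<ge> 0"
    by (rule has_integral_nonneg[OF \<psi>]) (use le powr_ge_zero order_trans in blast)
  have "M > 0"
    using M by (rule le_less_trans[OF powr_ge_zero])
  have "j = (j powr (1 / q)) powr q"
    using q j by (simp add: powr_powr)
  also have "\<dots> \<le> M powr q"
    using M q by (intro powr_mono2) auto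
  finally have jM: "j \<le> M powr q" .
  \<comment> \<open>the exponent conjugate to \<open>q\<close>\<close>
  define r where "r = q / (q - 1)"
  have r: "r > 1" "1 / q + 1 / r = 1" "(q - 1) * r = q"
    using q by (auto simp: r_def field_simps)
  have Young: "norm (\<phi> t * M powr (q - 1)) \<le> (\<psi> t / q + M powr q / r) \<bullet> 1"
    if "t \<in> {0..1}" for t
  proof -
    have "\<bar>\<phi> t\<bar> * M powr (q - 1) \<le> \<bar>\<phi> t\<bar> powr q / q + (M powr (q - 1)) powr r / r"
      by (rule Youngs_inequality) (use q r in auto)
    also have "\<dots> \<le> \<psi> t / q + M powr q / r"
      using le[OF that] q r(3) by (simp add: powr_powr divide_right_mono)
    finally show ?thesis
      by (simp add: abs_mult)
  qed
  have "((\<lambda>t. \<psi> t / q + M powr q / r) has_integral (j / q + M powr q / r)) {0..1}"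
    using has_integral_add[OF has_integral_divide[OF \<psi>] has_integral_const_real[of "M powr q / r" 0 1]]
    by simp
  from has_integral_norm_bound_integral_component[OF has_integral_mult_left[OF \<phi>] this Young]
  have "\<bar>i\<bar> * M powr (q - 1) \<le> j / q + M powr q / r"
    by (simp add: abs_mult)
  also have "\<dots> \<le> M powr q / q + M powr q / r"
    using jM q by (simp add: divide_right_mono)
  also have "\<dots> = M powr q * (1 / q + 1 / r)"
    by (simp add: algebra_simps)
  also have "\<dots> = M * M powr (q - 1)"
    using r(2) \<open>M > 0\<close> by (simp add: powr_diff)
  finally show "\<bar>i\<bar> \<le> M"
    using \<open>M > 0\<close> by simp
qed

text \<open>
  The convention \<open>0\<^sup>0 = 1\<close> only changes Euler's integrand at \<open>t = 0\<close>.
\<close>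

lemma rpow_has_integral_Beta:
  assumes "\<alpha> \<ge> 0" "q > -1"
  shows "((\<lambda>t. rpow t \<alpha> * (1 - t) powr q) has_integral Beta (\<alpha> + 1) (q + 1)) {0..1}"
proof (rule has_integral_spike[of "{0}"])
  show "((\<lambda>t. t powr \<alpha> * (1 - t) powr q) has_integral Beta (\<alpha> + 1) (q + 1)) {0..1}"
    using has_integral_Beta_real[of "\<alpha> + 1" "q + 1"] assms by simp
qed (auto simp: rpow_def)

lemma Beta_1_left:
  fixes y :: real
  assumes "y > 0"
  shows "Beta 1 y = 1 / y"
proof -
  have "Gamma (y + 1) = y * Gamma y"
    using assms by (intro Gamma_plus1) (auto elim!: nonpos_Ints_cases)
  then show ?thesis
    using Gamma_real_pos[OF assms] by (simp add: Beta_def add.commute)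
qed

text \<open>
  A single antiderivative carries both integrations by parts together with the integral of \<open>f\<close>,
  expressed through a primitive \<open>F\<close> of \<open>f\<close>. It works for either sign of \<open>c - a\<close>.
\<close>

lemma trapezoid_error_has_integral:
  fixes f f' f'' :: "real \<Rightarrow> real"
  defines "S \<equiv> \<lambda>a c. {min a c..max a c}"
  assumes "a \<noteq> c"
    and f: "\<And>x. x \<in> S a c \<Longrightarrow> (f has_real_derivative f' x) (at x within S a c)"
    and f': "\<And>x. x \<in> S a c \<Longrightarrow> (f' has_real_derivative f'' x) (at x within S a c)"
  shows "((\<lambda>t. t * (1 - t) * f'' (t * a + (1 - t) * c)) has_integral
           2 / (c - a)\<^sup>2 * ((f a + f c) / 2
             - 1 / (c - a) * (LBINT x=ereal a..ereal c. f x))) {0..1}"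
proof -
  define d where "d = c - a"
  have d: "d \<noteq> 0"
    using \<open>a \<noteq> c\<close> by (simp add: d_def)
  define x where "x = (\<lambda>t. t * a + (1 - t) * c)"
  have cont: "continuous_on (S a c) f"
    using f by (rule DERIV_continuous_on)
  then obtain F where F: "\<And>y. y \<in> S a c \<Longrightarrow> (F has_vector_derivative f y) (at y within S a c)"
    unfolding S_def by (rule antiderivative_continuous) blast
  have LBINT: "(LBINT x=ereal a..ereal c. f x) = F c - F a"
    by (rule interval_integral_FTC_finite) (use cont F in \<open>auto simp: S_def\<close>)
  have xS: "x t \<in> S a c" if "t \<in> {0..1}" for t
  proof -
    have "x t \<in> closed_segment c a"
      using that unfolding x_def closed_segment_def by (auto intro!: exI[of _ t])
    then show ?thesis
      by (auto simp: S_def closed_segment_eq_real_ivl split: if_splits)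
  qed
  have chain: "((\<lambda>t. g (x t)) has_real_derivative g' (x t) * (- d)) (at t within {0..1})"
    if g: "\<And>y. y \<in> S a c \<Longrightarrow> (g has_real_derivative g' y) (at y within S a c)"
      and t: "t \<in> {0..1}" for g g' t
  proof -
    have dx: "(x has_real_derivative - d) (at t within {0..1})"
      unfolding x_def d_def by (auto intro!: derivative_eq_intros)
    have "(g has_real_derivative g' (x t)) (at (x t) within x ` {0..1})"
      by (rule DERIV_subset[OF g]) (use xS t in auto)
    from DERIV_image_chain[OF this dx] show ?thesis
      by (simp add: o_def)
  qed
  define G where "G = (\<lambda>t. - d * (t * (1 - t) * f' (x t)) - (1 - 2 * t) * f (x t) + 2 / d * F (x t))"
  have "((\<lambda>t. t * (1 - t) * f'' (x t) * d\<^sup>2) has_integral (G 1 - G 0)) {0..1}"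
  proof (rule fundamental_theorem_of_calculus)
    fix t :: real assume t: "t \<in> {0..1}"
    have F': "\<And>y. y \<in> S a c \<Longrightarrow> (F has_real_derivative f y) (at y within S a c)"
      using F by (simp add: has_real_derivative_iff_has_vector_derivative)
    have "(G has_real_derivative t * (1 - t) * f'' (x t) * d\<^sup>2) (at t within {0..1})"
      unfolding G_def
      by (rule DERIV_cong,
          (rule chain[OF f t] chain[OF f' t] chain[OF F' t] derivative_intros | assumption)+)
        (use d in \<open>simp add: field_simps power2_eq_square\<close>)
    then show "(G has_vector_derivative t * (1 - t) * f'' (x t) * d\<^sup>2) (at t within {0..1})"
      by (simp add: has_real_derivative_iff_has_vector_derivative)
  qed simp
  moreover have "G 1 - G 0 = 2 * ((f a + f c) / 2 - 1 / d * (F c - F a))"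
    by (simp add: G_def x_def algebra_simps)
  ultimately have "((\<lambda>t. t * (1 - t) * f'' (x t) * d\<^sup>2 / d\<^sup>2) has_integral
      2 * ((f a + f c) / 2 - 1 / d * (F c - F a)) / d\<^sup>2) {0..1}"
    using has_integral_divide by metis
  then show ?thesis
    using d unfolding LBINT by (simp add: x_def d_def mult.assoc)
qed

theorem theorem5:
  fixes f f' f'' :: "real \<Rightarrow> real" and I :: "real set"
    and bstar a b \<alpha> m p q :: real
  assumes "bstar > 0"
    and "is_interval I" and "I \<subseteq> {0..bstar}"
    and "a \<in> I" and "b \<in> I" and "a < b"
    and "m * b \<in> I" and "m * b \<noteq> a"
    and "\<forall>x \<in> interior I \<union> {a, b, m * b}. (f has_real_derivative f' x) (at x within I)"
    and "\<forall>x \<in> interior I \<union> {a, b, m * b}. (f' has_real_derivative f'' x) (at x within I)"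
    and "f'' absolutely_integrable_on {a..b}"
    and "\<alpha> \<in> {0..1}" and "m \<in> {0..1}"
    and "q > 1" and "1 / p + 1 / q = 1"
    and "alpha_m_convex_on \<alpha> m {a..b} (\<lambda>x. \<bar>f'' x\<bar> powr q)"
  shows "\<bar>(f a + f (m * b)) / 2
            - 1 / (m * b - a) * (LBINT x=ereal a..ereal (m * b). f x)\<bar>
         \<le> (m * b - a)\<^sup>2 / 2 *
            (\<bar>f'' a\<bar> powr q * Beta (\<alpha> + 1) (q + 1)
             + m * \<bar>f'' b\<bar> powr q * (1 / (q + 1) - Beta (\<alpha> + 1) (q + 1))) powr (1 / q)"
proof -
  define c where "c = m * b"
  define S where "S = {min a c..max a c}"
  define A where "A = \<bar>f'' a\<bar> powr q"
  define B where "B = \<bar>f'' b\<bar> powr q"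
  define E where "E = (f a + f c) / 2 - 1 / (c - a) * (LBINT x=ereal a..ereal c. f x)"
  define \<Theta> where "\<Theta> = Beta (\<alpha> + 1) (q + 1)"
  have "c \<noteq> a" "c \<in> I"
    using assms by (auto simp: c_def)
  have SI: "S \<subseteq> I"
  proof
    fix x assume "x \<in> S"
    show "x \<in> I"
    proof (rule mem_is_interval_1_I[OF \<open>is_interval I\<close>])
      show "min a c \<in> I" "max a c \<in> I"
        using \<open>a \<in> I\<close> \<open>c \<in> I\<close> by (auto simp: min_def max_def)
    qed (use \<open>x \<in> S\<close> in \<open>auto simp: S_def\<close>)
  qed
  have inner: "{min a c<..<max a c} \<subseteq> interior I"
    by (rule interior_maximal) (use SI in \<open>auto simp: S_def\<close>)
  have "x \<in> interior I \<union> {a, b, m * b}" if "x \<in> S" for x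
  proof -
    have "x = a \<or> x = c \<or> x \<in> {min a c<..<max a c}"
      using that unfolding S_def by auto
    then show ?thesis
      using inner unfolding c_def by blast
  qed
  then have deriv:
    "(f has_real_derivative f' x) (at x within S)" "(f' has_real_derivative f'' x) (at x within S)"
    if "x \<in> S" for x
    using assms(9,10) that by (auto intro!: DERIV_subset[OF _ SI])
  have error: "((\<lambda>t. t * (1 - t) * f'' (t * a + (1 - t) * c)) has_integral
      2 / (c - a)\<^sup>2 * E) {0..1}"
    unfolding E_def
    by (rule trapezoid_error_has_integral) (use \<open>c \<noteq> a\<close> deriv in \<open>auto simp: S_def\<close>)
  have Beta_int: "((\<lambda>t. rpow t \<alpha> * (1 - t) powr q) has_integral \<Theta>) {0..1}"
    unfolding \<Theta>_def using assms by (intro rpow_has_integral_Beta) auto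
  have "((\<lambda>t. (1 - t) powr q) has_integral 1 / (q + 1)) {0..1}"
    using rpow_has_integral_Beta[of 0 q] Beta_1_left[of "q + 1"] \<open>q > 1\<close> by (simp add: rpow_def)
  from has_integral_add[OF has_integral_mult_right[OF Beta_int, of A]
      has_integral_mult_right[OF has_integral_diff[OF this Beta_int], of "m * B"]]
  have bound: "((\<lambda>t. (1 - t) powr q * (rpow t \<alpha> * A + m * (1 - rpow t \<alpha>) * B)) has_integral
      A * \<Theta> + m * B * (1 / (q + 1) - \<Theta>)) {0..1}"
    by (simp add: algebra_simps)
  have pointwise: "\<bar>t * (1 - t) * f'' (t * a + (1 - t) * c)\<bar> powr q
      \<le> (1 - t) powr q * (rpow t \<alpha> * A + m * (1 - rpow t \<alpha>) * B)" if t: "t \<in> {0..1}" for t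
  proof -
    have "\<bar>t * (1 - t) * f'' (t * a + (1 - t) * c)\<bar> \<le> (1 - t) * \<bar>f'' (t * a + (1 - t) * c)\<bar>"
      using t by (auto simp: abs_mult intro!: mult_right_mono mult_left_le_one_le)
    then have "\<bar>t * (1 - t) * f'' (t * a + (1 - t) * c)\<bar> powr q
        \<le> ((1 - t) * \<bar>f'' (t * a + (1 - t) * c)\<bar>) powr q"
      using \<open>q > 1\<close> by (intro powr_mono2) auto
    also have "\<dots> = (1 - t) powr q * \<bar>f'' (t * a + m * (1 - t) * b)\<bar> powr q"
      using t by (simp add: powr_mult c_def mult.assoc mult.left_commute)
    also have "\<dots> \<le> (1 - t) powr q * (rpow t \<alpha> * A + m * (1 - rpow t \<alpha>) * B)"
      using assms(16) t \<open>a < b\<close> unfolding alpha_m_convex_on_def A_def B_def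
      by (intro mult_left_mono) auto
    finally show ?thesis .
  qed
  have "2 / (c - a)\<^sup>2 * \<bar>E\<bar> \<le> (A * \<Theta> + m * B * (1 / (q + 1) - \<Theta>)) powr (1 / q)"
    using abs_integral_le_root_integral[OF \<open>q > 1\<close> error bound pointwise] by (simp add: abs_mult)
  then have "\<bar>E\<bar> \<le> (c - a)\<^sup>2 / 2 * (A * \<Theta> + m * B * (1 / (q + 1) - \<Theta>)) powr (1 / q)"
    using \<open>c \<noteq> a\<close> by (simp add: field_simps)
  then show ?thesis
    by (simp only: E_def A_def B_def \<Theta>_def c_def)
qed

end
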